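(* Let $X$ be a finite set of clocks, let $\alpha: X \to \mathbb{N}$ be a bound function, and let $Z, Z'$ be zones over $X$. Then $Z \not\subseteq \mathit{Closure}_\alpha(Z')$ if and only if there exist clocks $x, y \in X$ (both different from $x_0$) such that at least one of the following holds: 1. $Z'_{0x} < Z_{0x}$ and $Z'_{0x} \le (\le,\alpha_x)$; or 2. $Z'_{x0} < Z_{x0}$ and $Z_{x0} \ge (\le,-\alpha_x)$; or 3. $Z_{x0} \ge (\le,-\alpha_x)$ and $Z'_{xy} < Z_{xy}$ and $Z'_{xy} \le (\le,\alpha_y) + \lfloor Z_{x0}\rfloor$.
   Context: Clock valuations are maps $v: X \to \mathbb{R}_{\ge 0}$. A zone is a set of valuations defined by a conjunction of constraints of the form $x - y \,\#\, c$ or $x \,\#\, c$ with $x,y\in X$, $c \in \mathbb{N}$, $\# \in \{<,\le,=,\ge,>\}$. Weights are pairs $(\preccurlyeq, c)$ with $\preccurlyeq\in\{\le,<\}$ and $c \in \mathbb{Z}\cup\{\pm\infty\}$, with: order $(\preccurlyeq_1,c_1)<(\preccurlyeq_2,c_2)$ iff $c_1<c_2$, or $c_1=c_2$, $\preccurlyeq_1$ is $<$ and $\preccurlyeq_2$ is $\le$; addition $(\preccurlyeq_1,c_1)+(\preccurlyeq_2,c_2)=(\preccurlyeq,c_1+c_2)$ where $\preccurlyeq$ is $<$ iff $\preccurlyeq_1$ or $\preccurlyeq_2$ is $<$; floor $\lfloor(<,c)\rfloor=(\le,c-1)$, $\lfloor(\le,c)\rfloor=(\le,c)$. A distance graph has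 vertex set $X\cup\{x_0\}$, where $x_0$ is a special clock always equal to $0$ (written $0$ in subscripts), and an edge $x\to y$ of weight $(\preccurlyeq,c)$ for each pair, representing the constraint $y - x \preccurlyeq c$. It is in canonical form if the weight of each edge $x\to y$ equals the least weight (sum of edge weights) of a path from $x$ to $y$. For a zone $Z$, $Z_{xy}$ denotes the weight of the edge $x\to y$ in the canonical distance graph representing $Z$. A region with respect to $\alpha$ is a set of valuations specified by: for each clock $x$, one constraint among $x=c$ ($c=0,\dots,\alpha_x$), $c-1<x<c$ ($c=1,\dots,\alpha_x$), $x>\alpha_x$; and for each pair of clocks $x,y$ both having constraints of the form $c-1<x<c$, $d-1<y<d$, whether the fractional part of $x$ is less than, equal to, or greater than that of $y$. Regions partition the set of valuations. $\mathit{Closure}_\alpha(S)$ is the union of all regions (w.r.t. $\alpha$) that intersect $S$. *)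

theory Defs
  imports Complex_Main "HOL-Library.Extended" "HOL-Library.FuncSet"
begin

text \<open>Weights: \<open>Le c\<close> stands for $(\le, c)$ and \<open>Lt c\<close> for $(<, c)$, with $c$ an integer or
  \<open>Pinf\<close>, \<open>Minf\<close>.\<close>

datatype weight = is_Le: Le (bound: "int extended") | is_Lt: Lt (bound: "int extended")

instantiation weight :: linorder
begin

definition less_weight :: "weight \<Rightarrow> weight \<Rightarrow> bool" where
  "a < b \<longleftrightarrow> bound a < bound b \<or> (bound a = bound b \<and> is_Lt a \<and> is_Le b)"

definition less_eq_weight :: "weight \<Rightarrow> weight \<Rightarrow> bool" where
  "a \<le> b \<longleftrightarrow> a < b \<or> a = (b :: weight)"

instance
proof
  fix a b c :: weight
  show "a < b \<longleftrightarrow> a \<le> b \<and> \<not> b \<le> a"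
    by (cases a; cases b) (auto simp: less_eq_weight_def less_weight_def)
  show "a \<le> a"
    by (simp add: less_eq_weight_def)
  show "a \<le> b \<Longrightarrow> b \<le> c \<Longrightarrow> a \<le> c"
    by (cases a; cases b; cases c) (auto simp: less_eq_weight_def less_weight_def)
  show "a \<le> b \<Longrightarrow> b \<le> a \<Longrightarrow> a = b"
    by (cases a; cases b) (auto simp: less_eq_weight_def less_weight_def)
  show "a \<le> b \<or> b \<le> a"
    by (cases a; cases b) (auto simp: less_eq_weight_def less_weight_def)
qed

end

instantiation weight :: comm_monoid_add
begin

definition zero_weight :: weight where
  "0 = Le 0"

definition plus_weight :: "weight \<Rightarrow> weight \<Rightarrow> weight" where
  "a + b = (if is_Lt a \<or> is_Lt b then Lt (bound a + bound b) else Le (bound a + bound b))"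

instance
proof
  fix a b c :: weight
  show "a + b + c = a + (b + c)"
    by (auto simp: plus_weight_def add_ac)
  show "a + b = b + a"
    by (auto simp: plus_weight_def add_ac)
  show "0 + a = a"
    by (cases a) (auto simp: zero_weight_def plus_weight_def)
qed

end

fun weight_floor :: "weight \<Rightarrow> weight" where
  "weight_floor (Le c) = Le c"
| "weight_floor (Lt c) = Le (c - 1)"

fun weight_sat :: "real \<Rightarrow> weight \<Rightarrow> bool" where
  "weight_sat r (Le (Fin c)) \<longleftrightarrow> r \<le> of_int c"
| "weight_sat r (Lt (Fin c)) \<longleftrightarrow> r < of_int c"
| "weight_sat r (Le Pinf) \<longleftrightarrow> True"
| "weight_sat r (Lt Pinf) \<longleftrightarrow> True"
| "weight_sat r (Le Minf) \<longleftrightarrow> False"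
| "weight_sat r (Lt Minf) \<longleftrightarrow> False"

definition valuations :: "'x set \<Rightarrow> ('x \<Rightarrow> real) set" where
  "valuations X = (X \<rightarrow>\<^sub>E {0..})"

datatype cmp = LT | LE | EQ | GE | GT

fun cmp_sat :: "cmp \<Rightarrow> real \<Rightarrow> real \<Rightarrow> bool" where
  "cmp_sat LT a b \<longleftrightarrow> a < b"
| "cmp_sat LE a b \<longleftrightarrow> a \<le> b"
| "cmp_sat EQ a b \<longleftrightarrow> a = b"
| "cmp_sat GE a b \<longleftrightarrow> a \<ge> b"
| "cmp_sat GT a b \<longleftrightarrow> a > b"

datatype 'x constraint = Single 'x cmp nat | Diff 'x 'x cmp nat

fun constraint_sat :: "('x \<Rightarrow> real) \<Rightarrow> 'x constraint \<Rightarrow> bool" where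
  "constraint_sat v (Single x r c) \<longleftrightarrow> cmp_sat r (v x) (real c)"
| "constraint_sat v (Diff x y r c) \<longleftrightarrow> cmp_sat r (v x - v y) (real c)"

definition zone :: "'x set \<Rightarrow> ('x \<Rightarrow> real) set \<Rightarrow> bool" where
  "zone X Z \<longleftrightarrow> (\<exists>C. finite C \<and> (\<forall>c\<in>C. set_constraint c \<subseteq> X) \<and>
     Z = {v \<in> valuations X. \<forall>c\<in>C. constraint_sat v c})"

text \<open>The vertices of a distance graph are \<open>None\<close>, the special clock $x_0$, and \<open>Some x\<close> for the
  clocks $x$; \<open>G p q\<close> is the weight of the edge from \<open>p\<close> to \<open>q\<close>.\<close>

type_synonym 'x dgraph = "'x option \<Rightarrow> 'x option \<Rightarrow> weight"

definition vertices :: "'x set \<Rightarrow> 'x option set" where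
  "vertices X = insert None (Some ` X)"

definition vertex_value :: "('x \<Rightarrow> real) \<Rightarrow> 'x option \<Rightarrow> real" where
  "vertex_value v p = (case p of None \<Rightarrow> 0 | Some x \<Rightarrow> v x)"

text \<open>All real-valued maps are considered here, so that a graph whose solution set is a zone has to
  contain the constraints $x_0 - x \le 0$ itself. If only non-negative maps were considered, these
  constraints could be omitted and the canonical graph of a zone would not be determined.\<close>

definition dg_solutions :: "'x set \<Rightarrow> 'x dgraph \<Rightarrow> ('x \<Rightarrow> real) set" where
  "dg_solutions X G = {v \<in> X \<rightarrow>\<^sub>E UNIV. \<forall>p\<in>vertices X. \<forall>q\<in>vertices X.
     weight_sat (vertex_value v q - vertex_value v p) (G p q)}"

text \<open>A path is given by the nonempty list of its vertices; the one-vertex path has weight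
  $(\le, 0)$.\<close>

fun path_weight :: "'x dgraph \<Rightarrow> 'x option list \<Rightarrow> weight" where
  "path_weight G (p # q # ps) = G p q + path_weight G (q # ps)"
| "path_weight G _ = 0"

definition paths :: "'x set \<Rightarrow> 'x option \<Rightarrow> 'x option \<Rightarrow> 'x option list set" where
  "paths X p q = {ps. ps \<noteq> [] \<and> set ps \<subseteq> vertices X \<and> hd ps = p \<and> last ps = q}"

definition canonical_form :: "'x set \<Rightarrow> 'x dgraph \<Rightarrow> bool" where
  "canonical_form X G \<longleftrightarrow> (\<forall>p\<in>vertices X. \<forall>q\<in>vertices X.
     G p q \<in> path_weight G ` paths X p q \<and> (\<forall>w \<in> path_weight G ` paths X p q. G p q \<le> w))"

text \<open>Nonempty zones have exactly one canonical graph, up to the choice between \<open>Le Pinf\<close> and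
  \<open>Lt Pinf\<close> for absent constraints. The empty zone has many (cycles of weight \<open>Lt 0\<close> do not
  prevent the existence of least path weights); by convention its graph is the one whose weights
  are all equal to the least weight \<open>Lt Minf\<close>.\<close>

definition canonical_graph_of :: "'x set \<Rightarrow> ('x \<Rightarrow> real) set \<Rightarrow> 'x dgraph \<Rightarrow> bool" where
  "canonical_graph_of X Z G \<longleftrightarrow> canonical_form X G \<and> dg_solutions X G = Z \<and>
     (Z = {} \<longrightarrow> (\<forall>p\<in>vertices X. \<forall>q\<in>vertices X. G p q = Lt Minf))"

text \<open>The constraint put on a clock by a region: \<open>Const c\<close> is $x = c$, \<open>Intv c\<close> is $c - 1 < x < c$
  and \<open>Above\<close> is $x > \alpha_x$.\<close>

datatype clock_constr = Const nat | is_Intv: Intv nat | Above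

fun clock_constr_valid :: "nat \<Rightarrow> clock_constr \<Rightarrow> bool" where
  "clock_constr_valid a (Const c) \<longleftrightarrow> c \<le> a"
| "clock_constr_valid a (Intv c) \<longleftrightarrow> 1 \<le> c \<and> c \<le> a"
| "clock_constr_valid a Above \<longleftrightarrow> True"

fun clock_constr_sat :: "nat \<Rightarrow> real \<Rightarrow> clock_constr \<Rightarrow> bool" where
  "clock_constr_sat a r (Const c) \<longleftrightarrow> r = real c"
| "clock_constr_sat a r (Intv c) \<longleftrightarrow> real c - 1 < r \<and> r < real c"
| "clock_constr_sat a r Above \<longleftrightarrow> r > real a"

definition region :: "'x set \<Rightarrow> ('x \<Rightarrow> nat) \<Rightarrow> ('x \<Rightarrow> real) set \<Rightarrow> bool" where
  "region X \<alpha> R \<longleftrightarrow> R \<noteq> {} \<and> (\<exists>I f.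
     (\<forall>x\<in>X. clock_constr_valid (\<alpha> x) (I x)) \<and>
     (\<forall>x\<in>X. \<forall>y\<in>X. f x y \<in> {LT, EQ, GT}) \<and>
     R = {v \<in> valuations X. (\<forall>x\<in>X. clock_constr_sat (\<alpha> x) (v x) (I x)) \<and>
       (\<forall>x\<in>X. \<forall>y\<in>X. is_Intv (I x) \<and> is_Intv (I y) \<longrightarrow>
          cmp_sat (f x y) (frac (v x)) (frac (v y)))})"

definition Closure :: "'x set \<Rightarrow> ('x \<Rightarrow> nat) \<Rightarrow> ('x \<Rightarrow> real) set \<Rightarrow> ('x \<Rightarrow> real) set" where
  "Closure X \<alpha> S = \<Union> {R. region X \<alpha> R \<and> R \<inter> S \<noteq> {}}"

lemma weight_sat_mono:
  assumes "weight_sat r a" "a \<le> b" shows "weight_sat r b"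
  using assms
  by (cases "(r, a)" rule: weight_sat.cases; cases "(r, b)" rule: weight_sat.cases)
    (auto simp: less_eq_weight_def less_weight_def)

lemma weight_sat_add:
  assumes "weight_sat r a" "weight_sat s b" shows "weight_sat (r + s) (a + b)"
  using assms
  by (cases "(r, a)" rule: weight_sat.cases; cases "(s, b)" rule: weight_sat.cases)
    (auto simp: plus_weight_def)

lemma weight_sat_path:
  assumes "v \<in> dg_solutions X G" "ps \<in> paths X p q"
  shows "weight_sat (vertex_value v q - vertex_value v p) (path_weight G ps)"
  using assms(2)
proof (induction ps arbitrary: p rule: induct_list012)
  case (3 a b ps)
  then have "b # ps \<in> paths X b q" "a = p" "a \<in> vertices X" "b \<in> vertices X"
    by (auto simp: paths_def)
  then have "weight_sat (vertex_value v q - vertex_value v b) (path_weight G (b # ps))"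
    "weight_sat (vertex_value v b - vertex_value v p) (G p b)"
    using 3 assms(1) by (auto simp: dg_solutions_def)
  from weight_sat_add[OF this(2,1)] show ?case
    using \<open>a = p\<close> by simp
qed (auto simp: paths_def zero_weight_def zero_extended_def)

lemma least_weight_exists:
  assumes "W \<noteq> {}" "\<And>w. w \<in> W \<Longrightarrow> weight_sat r w"
  shows "\<exists>m\<in>W. \<forall>w\<in>W. m \<le> w"
proof (cases "\<exists>w\<in>W. bound w \<noteq> Pinf")
  case False
  then have "w = Le Pinf \<or> w = Lt Pinf" if "w \<in> W" for w
    using that by (cases w) auto
  moreover have "Lt Pinf \<le> Le Pinf"
    by (simp add: less_eq_weight_def less_weight_def)
  ultimately show ?thesis
    using assms(1) by (metis all_not_in_conv order_refl)
next
  case True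
  define k where "k w = nat (case w of Le (Fin c) \<Rightarrow> 2 * (c - \<lfloor>r\<rfloor>) + 1 | Lt (Fin c) \<Rightarrow> 2 * (c - \<lfloor>r\<rfloor>) | _ \<Rightarrow> 0)"
    for w
  define P where "P w \<longleftrightarrow> w \<in> W \<and> bound w \<noteq> Pinf" for w
  from True obtain w0 where "P w0" by (auto simp: P_def)
  then obtain m where m: "P m" "\<And>w. P w \<Longrightarrow> k m \<le> k w"
    using ex_has_least_nat[of P w0 k] by blast
  have "m \<le> w" if "w \<in> W" for w
  proof (cases "bound w = Pinf")
    case True
    with m(1) show ?thesis
      by (cases "bound m") (auto simp: less_eq_weight_def less_weight_def P_def)
  next
    case False
    with that have "k m \<le> k w" by (intro m) (simp add: P_def)
    moreover have "weight_sat r m" "weight_sat r w"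
      using m(1) that assms(2) by (auto simp: P_def)
    moreover obtain c where c: "bound m = Fin c"
      using m(1) \<open>weight_sat r m\<close> by (cases m; cases "bound m") (auto simp: P_def)
    moreover obtain d where d: "bound w = Fin d"
      using False \<open>weight_sat r w\<close> by (cases w; cases "bound w") auto
    moreover have "\<lfloor>r\<rfloor> \<le> c" "\<lfloor>r\<rfloor> \<le> d"
      using \<open>weight_sat r m\<close> \<open>weight_sat r w\<close> c d by (cases m; cases w; simp; linarith)+
    ultimately show ?thesis
      by (cases m; cases w) (auto simp: less_eq_weight_def less_weight_def k_def)
  qed
  with m(1) show ?thesis by (auto simp: P_def)
qed

lemma path_weight_append:
  "ps \<noteq> [] \<Longrightarrow> path_weight G (ps @ qs) = path_weight G ps + path_weight G (last ps # qs)"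
  by (induction ps rule: induct_list012) (auto simp: add_ac)

lemma canonical_form_closure:
  assumes v: "v \<in> dg_solutions X G"
  obtains H where "canonical_form X H" "dg_solutions X H = dg_solutions X G"
proof
  define W where "W p q = path_weight G ` paths X p q" for p q
  define H where "H p q = (LEAST w. w \<in> W p q)" for p q
  have edge: "F p q \<in> path_weight F ` paths X p q" if "p \<in> vertices X" "q \<in> vertices X" for p q F
    using that by (intro image_eqI[of _ _ "[p, q]"]) (auto simp: paths_def)
  have H: "H p q \<in> W p q \<and> (\<forall>w\<in>W p q. H p q \<le> w)" if pq: "p \<in> vertices X" "q \<in> vertices X" for p q
  proof -
    have "weight_sat (vertex_value v q - vertex_value v p) w" if "w \<in> W p q" for w
      using that weight_sat_path[OF v] by (auto simp: W_def)
    then obtain m where m: "m \<in> W p q" "\<forall>w\<in>W p q. m \<le> w"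
      using least_weight_exists[of "W p q"] edge[OF pq, of G] W_def by (metis empty_iff)
    then have "H p q = m" unfolding H_def by (intro Least_equality) auto
    with m show ?thesis by simp
  qed
  have path: "path_weight H ps \<in> W p q" if "ps \<in> paths X p q" for ps p q
    using that
  proof (induction ps arbitrary: p rule: induct_list012)
    case (3 a b ps)
    then have *: "b # ps \<in> paths X b q" "a = p" "a \<in> vertices X" "b \<in> vertices X"
      by (auto simp: paths_def)
    then obtain ts where ts: "ts \<in> paths X b q" "path_weight H (b # ps) = path_weight G ts"
      using 3 by (auto simp: W_def)
    obtain us where us: "us \<in> paths X p b" "H p b = path_weight G us"
      using H[of p b] * by (auto simp: W_def)
    have ne: "us \<noteq> []" "last us = b"
      using us(1) by (auto simp: paths_def)
    obtain ts' where ts': "ts = b # ts'"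
      using ts(1) by (cases ts) (auto simp: paths_def)
    have "us @ ts' \<in> paths X p q"
      using us(1) ts(1) ts' by (auto simp: paths_def split: if_splits)
    moreover have "path_weight G (us @ ts') = path_weight H (a # b # ps)"
      using path_weight_append[OF ne(1), of G ts'] ne ts' us(2) ts(2) *(2) by simp
    ultimately show ?case by (metis W_def image_eqI)
  qed (force simp: W_def paths_def)+
  show "canonical_form X H"
    unfolding canonical_form_def
  proof (intro ballI conjI)
    fix p q assume pq: "p \<in> vertices X" "q \<in> vertices X"
    then show "H p q \<in> path_weight H ` paths X p q"
      by (rule edge)
    show "H p q \<le> w" if "w \<in> path_weight H ` paths X p q" for w
      using that path H[OF pq] by auto
  qed
  have "weight_sat (vertex_value u q - vertex_value u p) (H p q)"
    if "u \<in> dg_solutions X G" "p \<in> vertices X" "q \<in> vertices X" for u p q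
    using H[OF that(2,3)] weight_sat_path[OF that(1)] by (auto simp: W_def)
  moreover have "weight_sat (vertex_value u q - vertex_value u p) (G p q)"
    if "u \<in> dg_solutions X H" "p \<in> vertices X" "q \<in> vertices X" for u p q
  proof -
    have "H p q \<le> G p q"
      using H[OF that(2,3)] edge[OF that(2,3), of G] unfolding W_def by blast
    moreover have "weight_sat (vertex_value u q - vertex_value u p) (H p q)"
      using that by (simp add: dg_solutions_def)
    ultimately show ?thesis
      by (rule weight_sat_mono[rotated])
  qed
  ultimately show "dg_solutions X H = dg_solutions X G"
    by (fastforce simp: dg_solutions_def)
qed

fun cmp_edges :: "'x option \<Rightarrow> 'x option \<Rightarrow> cmp \<Rightarrow> nat \<Rightarrow> ('x option \<times> 'x option \<times> weight) set" where
  "cmp_edges p q LT c = {(p, q, Lt (Fin (int c)))}"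
| "cmp_edges p q LE c = {(p, q, Le (Fin (int c)))}"
| "cmp_edges p q EQ c = {(p, q, Le (Fin (int c))), (q, p, Le (Fin (- int c)))}"
| "cmp_edges p q GE c = {(q, p, Le (Fin (- int c)))}"
| "cmp_edges p q GT c = {(q, p, Lt (Fin (- int c)))}"

fun constraint_edges :: "'x constraint \<Rightarrow> ('x option \<times> 'x option \<times> weight) set" where
  "constraint_edges (Single x r c) = cmp_edges None (Some x) r c"
| "constraint_edges (Diff x y r c) = cmp_edges (Some y) (Some x) r c"

lemma cmp_edges_sat:
  "cmp_sat r (vertex_value v q - vertex_value v p) (real c) \<longleftrightarrow>
    (\<forall>(p, q, w)\<in>cmp_edges p q r c. weight_sat (vertex_value v q - vertex_value v p) w)"
  by (cases r) auto

lemma constraint_edges_sat: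
  "constraint_sat v c \<longleftrightarrow>
    (\<forall>(p, q, w)\<in>constraint_edges c. weight_sat (vertex_value v q - vertex_value v p) w)"
proof (cases c)
  case (Single x r n)
  then show ?thesis using cmp_edges_sat[of r v "Some x" None n] by (simp add: vertex_value_def)
next
  case (Diff x y r n)
  then show ?thesis using cmp_edges_sat[of r v "Some x" "Some y" n] by (simp add: vertex_value_def)
qed

lemma constraint_edges_vertices:
  assumes "set_constraint c \<subseteq> X" "(p, q, w) \<in> constraint_edges c"
  shows "p \<in> vertices X" "q \<in> vertices X"
proof -
  have *: "(p, q, w) \<in> cmp_edges a b r n \<Longrightarrow> {p, q} \<subseteq> {a, b}" for a b :: "'a option" and r n
    by (cases r) auto
  show "p \<in> vertices X" "q \<in> vertices X"
    using assms * by (cases c; fastforce simp: vertices_def)+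
qed

lemma finite_constraint_edges: "finite (constraint_edges c)"
proof -
  have "finite (cmp_edges p q r n)" for p q :: "'a option" and r n
    by (cases r) auto
  then show ?thesis by (cases c) auto
qed

lemma zone_dg_solutions:
  assumes "finite X" "zone X Z"
  obtains G where "dg_solutions X G = Z"
proof -
  obtain C where C: "finite C" "\<And>c. c \<in> C \<Longrightarrow> set_constraint c \<subseteq> X"
    and Z: "Z = {v \<in> valuations X. \<forall>c\<in>C. constraint_sat v c}"
    using assms(2) by (auto simp: zone_def)
  define E where "E = (\<Union>c\<in>C. constraint_edges c) \<union> (\<lambda>x. (Some x, None, Le 0)) ` X"
  define S where "S p q = insert (Lt Pinf) {w. (p, q, w) \<in> E}" for p q
  have "finite E"
    using assms(1) C(1) by (auto simp: E_def finite_constraint_edges)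
  then have "finite ((snd \<circ> snd) ` E)" by simp
  moreover have "{w. (p, q, w) \<in> E} \<subseteq> (snd \<circ> snd) ` E" for p q by force
  ultimately have fin: "finite (S p q)" for p q
    unfolding S_def by (meson finite_insert finite_subset)
  have Min_sat: "weight_sat r (Min (S p q)) \<longleftrightarrow> (\<forall>w. (p, q, w) \<in> E \<longrightarrow> weight_sat r w)" for r p q
  proof
    show "\<forall>w. (p, q, w) \<in> E \<longrightarrow> weight_sat r w" if "weight_sat r (Min (S p q))"
      using that fin[of p q] by (auto intro!: weight_sat_mono[OF that] Min_le simp: S_def)
    show "weight_sat r (Min (S p q))" if "\<forall>w. (p, q, w) \<in> E \<longrightarrow> weight_sat r w"
      using that Min_in[OF fin, of p q] by (auto simp: S_def)
  qed
  have E: "p \<in> vertices X \<and> q \<in> vertices X" if "(p, q, w) \<in> E" for p q w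
    using that C(2) constraint_edges_vertices unfolding E_def by (fastforce simp: vertices_def)
  have "v \<in> dg_solutions X (\<lambda>p q. Min (S p q)) \<longleftrightarrow> v \<in> Z" for v
  proof -
    have "v \<in> dg_solutions X (\<lambda>p q. Min (S p q)) \<longleftrightarrow> v \<in> X \<rightarrow>\<^sub>E UNIV \<and>
      (\<forall>(p, q, w)\<in>E. weight_sat (vertex_value v q - vertex_value v p) w)"
      unfolding dg_solutions_def Min_sat using E by blast
    also have "\<dots> \<longleftrightarrow> v \<in> X \<rightarrow>\<^sub>E UNIV \<and> (\<forall>x\<in>X. 0 \<le> v x) \<and> (\<forall>c\<in>C. constraint_sat v c)"
      by (auto simp: E_def constraint_edges_sat vertex_value_def zero_extended_def ball_Un)
    also have "\<dots> \<longleftrightarrow> v \<in> Z"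
      by (auto simp: Z valuations_def PiE_def)
    finally show ?thesis .
  qed
  then show thesis using that by blast
qed

lemma canonical_graph_exists:
  assumes "finite X" "zone X Z"
  obtains G where "canonical_graph_of X Z G"
proof (cases "Z = {}")
  case True
  have least: "Lt Minf \<le> w" for w
    by (cases "bound w"; cases w) (auto simp: less_eq_weight_def less_weight_def)
  have "Lt Minf \<in> path_weight (\<lambda>_ _. Lt Minf) ` paths X p q"
    if "p \<in> vertices X" "q \<in> vertices X" for p q
    using that by (intro image_eqI[of _ _ "[p, q]"])
      (auto simp: paths_def plus_weight_def zero_weight_def zero_extended_def)
  then have "canonical_form X (\<lambda>_ _. Lt Minf)"
    by (auto simp: canonical_form_def least)
  moreover have "dg_solutions X (\<lambda>_ _. Lt Minf) = {}"
    by (auto simp: dg_solutions_def vertices_def)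
  ultimately show thesis
    using True that[of "\<lambda>_ _. Lt Minf"] by (simp add: canonical_graph_of_def)
next
  case False
  obtain G where G: "dg_solutions X G = Z"
    using zone_dg_solutions[OF assms] .
  with False obtain v where "v \<in> dg_solutions X G" by blast
  then obtain H where "canonical_form X H" "dg_solutions X H = dg_solutions X G"
    by (rule canonical_form_closure)
  with G False show thesis
    by (intro that[of H]) (simp add: canonical_graph_of_def)
qed

end

theory Submission
  imports Defs
begin

text \<open>In a graph closed under the triangle inequality, a solution of the constraints between the
  vertices of a subset extends to all vertices, one vertex at a time, and it can be made to meet
  additional lower bounds on the new vertices as soon as each bound is compatible with each old
  vertex.

  If none of the three conditions holds and $v \in Z$, then $v$ itself satisfies every constraint
  of $Z'$ between $x_0$ and the clocks with $v(x) \le \alpha_x$, and the demands $x > \alpha_x$ on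
  the other clocks are compatible with it. The extension lies in $Z'$ and in the region of $v$.

  Conversely, extending from a single vertex $p$ shows that the constraints of $Z$ on the edges
  leaving $p$ are simultaneously tight. This gives a $v \in Z$ that violates the constraint of
  $Z'$ on the edge in question, and for the third condition also satisfies
  $-v(x) \ge \lfloor Z_{x0} \rfloor$. Then the whole region of $v$ violates the constraint.\<close>

section \<open>Weights as downward closed rays of reals\<close>

lemma weight_le_iff:
  fixes a b :: weight
  shows "a \<le> b \<longleftrightarrow> bound a < bound b \<or> bound a = bound b \<and> (is_Lt a \<or> is_Le b)"
  by (cases a; cases b) (auto simp: less_eq_weight_def less_weight_def)

lemma weight_sat_antimono:
  assumes "weight_sat s w" "r \<le> s" shows "weight_sat r w"
  using assms by (cases "(s, w)" rule: weight_sat.cases) auto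

lemma weight_sat_bound: "weight_sat r w \<Longrightarrow> bound w \<noteq> Minf"
  by (cases "(r, w)" rule: weight_sat.cases) auto

lemma weight_sat_ex:
  assumes "bound w \<noteq> Minf" shows "\<exists>r. weight_sat r w"
proof (cases "bound w")
  case (Fin c)
  then have "weight_sat (of_int c - 1) w" by (cases w) auto
  then show ?thesis by blast
next
  case Pinf
  then have "weight_sat 0 w" by (cases w) auto
  then show ?thesis by blast
qed (use assms in simp)

text \<open>Converse of \<open>weight_sat_add\<close>: a weight with bound other than
  \<open>Minf\<close> describes a nonempty downward ray, and the ray of a sum is the sum of the
  rays. It turns a triangle inequality into a value for the middle vertex.\<close>

lemma weight_sat_add_split:
  assumes "weight_sat r (a + b)" "bound a \<noteq> Minf" "bound b \<noteq> Minf"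
  shows "\<exists>s. weight_sat s a \<and> weight_sat (r - s) b"
proof (cases "bound a")
  case a: (Fin c)
  show ?thesis
  proof (cases "bound b")
    case b: (Fin d)
    show ?thesis
    proof (cases a)
      case (Le _)
      then show ?thesis
        using a b assms(1) by (intro exI[of _ "of_int c"]) (cases b; auto simp: plus_weight_def)
    next
      case (Lt _)
      show ?thesis
      proof (cases b)
        case (Le _)
        then show ?thesis
          using a b Lt assms(1)
          by (intro exI[of _ "r - of_int d"]) (auto simp: plus_weight_def)
      next
        case (Lt _)
        \<comment> \<open>Both constraints are strict, so the slack \<open>c + d - r\<close> is
          shared equally between them.\<close>
        then show ?thesis
          using a b \<open>a = Lt _\<close> assms(1)
          by (intro exI[of _ "(r + of_int c - of_int d) / 2"]) (auto simp: plus_weight_def field_simps)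
      qed
    qed
  next
    case Pinf
    obtain s where "weight_sat s a" using weight_sat_ex[OF assms(2)] by blast
    with Pinf show ?thesis by (intro exI[of _ s]) (cases b; auto)
  qed (use assms in simp)
next
  case Pinf
  obtain s where "weight_sat s b" using weight_sat_ex[OF assms(3)] by blast
  with Pinf show ?thesis by (intro exI[of _ "r - s"]) (cases a; auto)
qed (use assms in simp)

text \<open>The excluded bounds cover the pairs \<open>Lt Pinf < Le Pinf\<close> and
  \<open>Lt Minf < Le Minf\<close>, distinct weights satisfied by the same reals.\<close>

lemma less_weight_separate:
  assumes "a < b" "bound a \<noteq> Minf" "bound a \<noteq> Pinf"
  shows "\<exists>r. weight_sat r b \<and> \<not> weight_sat r a"
proof (cases "bound a")
  case a: (Fin c)
  show ?thesis
  proof (cases "bound b")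
    case b: (Fin d)
    show ?thesis
    proof (cases "is_Lt a")
      case True
      then show ?thesis using a b assms(1)
        by (intro exI[of _ "of_int c"]) (cases a; cases b; auto simp: less_weight_def)
    next
      case False
      \<comment> \<open>As \<open>a\<close> is of the form \<open>Le\<close>, the integer bound of
        \<open>b\<close> is at least \<open>c + 1\<close>, so a half-integer fits in between even if
        \<open>b\<close> is strict.\<close>
      then show ?thesis using a b assms(1)
        by (intro exI[of _ "of_int c + 1/2"]) (cases a; cases b; auto simp: less_weight_def; linarith)
    qed
  next
    case Pinf
    then show ?thesis using a
      by (intro exI[of _ "of_int c + 1"]) (cases a; cases b; auto)
  qed (use assms in \<open>auto simp: less_weight_def\<close>)
qed (use assms in \<open>auto simp: less_weight_def\<close>)

lemma less_if_weight_sat: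
  assumes "weight_sat r b" "\<not> weight_sat r a" shows "a < b"
  using assms weight_sat_mono not_le by blast

section \<open>Extending partial solutions\<close>

lemma finite_chain_least:
  fixes D :: "'i \<Rightarrow> 'a set"
  assumes "finite I" "I \<noteq> {}" "\<And>i j. i \<in> I \<Longrightarrow> j \<in> I \<Longrightarrow> D i \<subseteq> D j \<or> D j \<subseteq> D i"
  shows "\<exists>i\<in>I. \<forall>j\<in>I. D i \<subseteq> D j"
  using assms
proof (induction I rule: finite_ne_induct)
  case (insert a I)
  then obtain i where i: "i \<in> I" "\<forall>j\<in>I. D i \<subseteq> D j" by blast
  then have "D i \<subseteq> D a \<or> D a \<subseteq> D i" using insert.prems by blast
  with i show ?case by blast
qed simp

text \<open>A one-dimensional Helly argument: down-sets of a linear order form a chain, and so do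
  up-sets. A point common to the least down-set and the least up-set lies in all of them.\<close>

lemma down_up_sets_inter:
  fixes D :: "'i \<Rightarrow> 'a::linorder set" and U :: "'j \<Rightarrow> 'a set"
  assumes "finite I" "I \<noteq> {}" "finite J" "J \<noteq> {}"
    and D: "\<And>i s t. i \<in> I \<Longrightarrow> t \<in> D i \<Longrightarrow> s \<le> t \<Longrightarrow> s \<in> D i"
    and U: "\<And>j s t. j \<in> J \<Longrightarrow> s \<in> U j \<Longrightarrow> s \<le> t \<Longrightarrow> t \<in> U j"
    and meet: "\<And>i j. i \<in> I \<Longrightarrow> j \<in> J \<Longrightarrow> D i \<inter> U j \<noteq> {}"
  shows "\<exists>t. (\<forall>i\<in>I. t \<in> D i) \<and> (\<forall>j\<in>J. t \<in> U j)"
proof -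
  have "D i \<subseteq> D j \<or> D j \<subseteq> D i" if "i \<in> I" "j \<in> I" for i j
    by (metis D that linear subsetI)
  from finite_chain_least[of I D, OF assms(1,2) this] obtain i where i: "i \<in> I" "\<forall>k\<in>I. D i \<subseteq> D k"
    by blast
  have "U i \<subseteq> U j \<or> U j \<subseteq> U i" if "i \<in> J" "j \<in> J" for i j
    by (metis U that linear subsetI)
  from finite_chain_least[of J U, OF assms(3,4) this] obtain j where j: "j \<in> J" "\<forall>k\<in>J. U j \<subseteq> U k"
    by blast
  show ?thesis using meet[OF i(1) j(1)] i j by blast
qed

lemma extend_solution:
  fixes G :: "'v \<Rightarrow> 'v \<Rightarrow> weight" and u :: "'v \<Rightarrow> real"
  assumes "finite V" "S \<subseteq> V" "S \<noteq> {}"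
    and tri: "\<And>p q r. p \<in> V \<Longrightarrow> q \<in> V \<Longrightarrow> r \<in> V \<Longrightarrow> G p r \<le> G p q + G q r"
    and diag: "\<And>p. p \<in> V \<Longrightarrow> G p p = 0"
    and fin: "\<And>p q. p \<in> V \<Longrightarrow> q \<in> V \<Longrightarrow> bound (G p q) \<noteq> Minf"
    and up: "\<And>x s t. x \<in> V \<Longrightarrow> s \<in> A x \<Longrightarrow> s \<le> t \<Longrightarrow> t \<in> A x"
    and sat: "\<And>p q. p \<in> S \<Longrightarrow> q \<in> S \<Longrightarrow> weight_sat (u q - u p) (G p q)"
    and compat: "\<And>p x. p \<in> S \<Longrightarrow> x \<in> V - S \<Longrightarrow> \<exists>t\<in>A x. weight_sat (t - u p) (G p x)"
  shows "\<exists>u'. (\<forall>p\<in>S. u' p = u p) \<and> (\<forall>x\<in>V - S. u' x \<in> A x) \<and>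
    (\<forall>p\<in>V. \<forall>q\<in>V. weight_sat (u' q - u' p) (G p q))"
proof -
  have "finite (V - S)" using assms(1) by simp
  then show ?thesis
    using assms(2,3) sat compat
  proof (induction "V - S" arbitrary: S u rule: finite_psubset_induct)
    case psubset
    show ?case
    proof (cases "V - S = {}")
      case True
      with psubset.prems show ?thesis by (intro exI[of _ u]) auto
    next
      case False
      then obtain x where x: "x \<in> V" "x \<notin> S" by blast
      \<comment> \<open>Old and new vertices are treated alike: an old \<open>j\<close> must keep
        its value, a new one must still be able to meet its demand. Edges from old vertices to
        \<open>x\<close> then cut out down-sets of values for \<open>x\<close>, and edges from
        \<open>x\<close> to any \<open>j\<close> cut out up-sets.\<close>
      define W where "W j = (if j \<in> S then {u j} else A j)" for j
      have W: "\<exists>t\<in>W j. weight_sat (t - u p) (G p j)" if "p \<in> S" "j \<in> V" for p j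
        using that psubset.prems(3,4) by (auto simp: W_def)
      have "\<exists>t. (\<forall>p\<in>S. t \<in> {t. weight_sat (t - u p) (G p x)}) \<and>
          (\<forall>j\<in>V. t \<in> {t. \<exists>t'\<in>W j. weight_sat (t' - t) (G x j)})"
      proof (rule down_up_sets_inter)
        show "finite S" "S \<noteq> {}" "finite V" "V \<noteq> {}"
          using psubset.prems(1,2) assms(1) finite_subset x by auto
        fix p j assume pj: "p \<in> S" "j \<in> V"
        then obtain t' where t': "t' \<in> W j" "weight_sat (t' - u p) (G p j)" using W by blast
        \<comment> \<open>The compatibility of \<open>p\<close> with \<open>j\<close> is relaxed to
          the path through \<open>x\<close>; splitting the sum yields a value for \<open>x\<close>
          that suits both edges.\<close>
        have "weight_sat (t' - u p) (G p x + G x j)"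
          using weight_sat_mono[OF t'(2) tri] pj x psubset.prems(1) by blast
        then obtain s where s: "weight_sat s (G p x)" "weight_sat (t' - u p - s) (G x j)"
          using weight_sat_add_split fin pj x psubset.prems(1) by (meson subsetD)
        have "s + u p \<in> {t. weight_sat (t - u p) (G p x)} \<inter> {t. \<exists>t'\<in>W j. weight_sat (t' - t) (G x j)}"
          using s t' by (auto simp: algebra_simps)
        then show "{t. weight_sat (t - u p) (G p x)} \<inter> {t. \<exists>t'\<in>W j. weight_sat (t' - t) (G x j)} \<noteq> {}"
          by blast
      qed (auto intro: weight_sat_antimono elim!: bexI[rotated])
      then obtain t where t1: "\<And>p. p \<in> S \<Longrightarrow> weight_sat (t - u p) (G p x)"
        and t2: "\<And>j. j \<in> V \<Longrightarrow> \<exists>t'\<in>W j. weight_sat (t' - t) (G x j)" by auto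
      \<comment> \<open>For \<open>j = x\<close> the edge has weight 0, so \<open>t\<close> lies
        above some element of the upward closed set \<open>A x\<close>.\<close>
      have tA: "t \<in> A x"
        using t2[OF x(1)] x up diag
        by (auto simp: W_def zero_weight_def zero_extended_def)
      let ?u = "u(x := t)"
      have "\<exists>u'. (\<forall>p\<in>insert x S. u' p = ?u p) \<and> (\<forall>y\<in>V - insert x S. u' y \<in> A y) \<and>
        (\<forall>p\<in>V. \<forall>q\<in>V. weight_sat (u' q - u' p) (G p q))"
      proof (rule psubset.hyps(2))
        show "V - insert x S \<subset> V - S" "insert x S \<subseteq> V" "insert x S \<noteq> {}"
          using x psubset.prems(1) by auto
        show "weight_sat (?u q - ?u p) (G p q)" if "p \<in> insert x S" "q \<in> insert x S" for p q
          using that x t1 t2[of q] psubset.prems(1,3) diag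
          by (auto simp: W_def zero_weight_def zero_extended_def)
        show "\<exists>t\<in>A y. weight_sat (t - ?u p) (G p y)"
          if "p \<in> insert x S" "y \<in> V - insert x S" for p y
          using that x t2[of y] psubset.prems(4) by (auto simp: W_def)
      qed
      then obtain u' where "\<forall>p\<in>insert x S. u' p = ?u p" "\<forall>y\<in>V - insert x S. u' y \<in> A y"
        "\<forall>p\<in>V. \<forall>q\<in>V. weight_sat (u' q - u' p) (G p q)" by blast
      with x tA show ?thesis by (intro exI[of _ u']) auto
    qed
  qed
qed

section \<open>Canonical graphs with solutions\<close>

lemma canonical_triangle:
  assumes "canonical_form X G" "p \<in> vertices X" "q \<in> vertices X" "r \<in> vertices X"
  shows "G p r \<le> G p q + G q r"
proof -
  have "path_weight G [p, q, r] \<in> path_weight G ` paths X p r"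
    using assms by (intro imageI) (auto simp: paths_def)
  with assms show ?thesis by (fastforce simp: canonical_form_def)
qed

lemma dg_solutions_bound:
  assumes "v \<in> dg_solutions X G" "p \<in> vertices X" "q \<in> vertices X"
  shows "bound (G p q) \<noteq> Minf"
  using assms weight_sat_bound by (force simp: dg_solutions_def)

lemma canonical_diag:
  assumes "canonical_form X G" "v \<in> dg_solutions X G" "p \<in> vertices X"
  shows "G p p = 0"
proof (rule antisym)
  have "path_weight G [p] \<in> path_weight G ` paths X p p"
    using assms by (intro imageI) (auto simp: paths_def)
  with assms show "G p p \<le> 0" by (fastforce simp: canonical_form_def)
  have "weight_sat 0 (G p p)" using assms by (force simp: dg_solutions_def)
  then show "0 \<le> G p p"
    by (cases "(0::real, G p p)" rule: weight_sat.cases)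
      (auto simp: weight_le_iff zero_weight_def zero_extended_def)
qed

text \<open>Only differences matter to a graph, so the extension may move $x_0$ away from 0.
  Subtracting its value \<open>c\<close> there gives a genuine valuation.\<close>

lemma dg_solutions_extend:
  assumes X: "finite X" and G: "canonical_form X G" "dg_solutions X G \<noteq> {}"
    and S: "S \<subseteq> vertices X" "S \<noteq> {}"
    and up: "\<And>x s t. s \<in> A x \<Longrightarrow> s \<le> t \<Longrightarrow> t \<in> A x"
    and sat: "\<And>p q. p \<in> S \<Longrightarrow> q \<in> S \<Longrightarrow> weight_sat (u q - u p) (G p q)"
    and compat: "\<And>p x. p \<in> S \<Longrightarrow> x \<in> vertices X - S \<Longrightarrow> \<exists>t\<in>A x. weight_sat (t - u p) (G p x)"
  shows "\<exists>v\<in>dg_solutions X G. \<exists>c. (\<forall>p\<in>S. vertex_value v p = u p - c) \<and>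
    (\<forall>x\<in>vertices X - S. vertex_value v x + c \<in> A x)"
proof -
  obtain v0 where v0: "v0 \<in> dg_solutions X G" using G(2) by blast
  have "finite (vertices X)" using X by (simp add: vertices_def)
  then have "\<exists>u'. (\<forall>p\<in>S. u' p = u p) \<and> (\<forall>x\<in>vertices X - S. u' x \<in> A x) \<and>
      (\<forall>p\<in>vertices X. \<forall>q\<in>vertices X. weight_sat (u' q - u' p) (G p q))"
    by (rule extend_solution[OF _ S])
      (auto intro: canonical_triangle[OF G(1)] canonical_diag[OF G(1) v0] up sat compat
        dest: dg_solutions_bound[OF v0])
  then obtain u' where
    u': "\<And>p. p \<in> S \<Longrightarrow> u' p = u p" "\<And>x. x \<in> vertices X - S \<Longrightarrow> u' x \<in> A x"
    "\<And>p q. p \<in> vertices X \<Longrightarrow> q \<in> vertices X \<Longrightarrow> weight_sat (u' q - u' p) (G p q)"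
    by blast
  define v where "v = restrict (\<lambda>x. u' (Some x) - u' None) X"
  have v: "vertex_value v p = u' p - u' None" if "p \<in> vertices X" for p
    using that by (auto simp: vertices_def vertex_value_def v_def)
  show ?thesis
  proof (intro bexI exI conjI ballI)
    show "v \<in> dg_solutions X G"
      using u'(3) by (auto simp: dg_solutions_def v) (simp add: v_def)
    show "vertex_value v p = u p - u' None" if "p \<in> S" for p
      using that S v u' by auto
    show "vertex_value v x + u' None \<in> A x" if "x \<in> vertices X - S" for x
      using that v u' by auto
  qed
qed

section \<open>Regions and the closure\<close>

lemma weight_sat_same_unit:
  assumes "a = b \<or> (\<exists>k. of_int k < a \<and> a < of_int (k + 1) \<and> of_int k < b \<and> b < of_int (k + 1))"
    and "weight_sat a w"
  shows "weight_sat b w"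
proof (cases "a = b")
  case False
  then obtain k where k: "of_int k < a" "a < of_int (k + 1)" "of_int k < b" "b < of_int (k + 1)"
    using assms(1) by blast
  \<comment> \<open>Bounds of weights are integers: one that is not below a point of the open
    interval from \<open>k\<close> to \<open>k + 1\<close> is at least \<open>k + 1\<close>.\<close>
  have "b < of_int c" if "a \<le> of_int c" for c :: int
  proof -
    have "of_int k < (of_int c :: real)" using k that by linarith
    then have "k + 1 \<le> c" by simp
    then have "of_int (k + 1) \<le> (of_int c :: real)" by (simp only: of_int_le_iff)
    with k show ?thesis by linarith
  qed
  with assms(2) show ?thesis
    by (cases "(a, w)" rule: weight_sat.cases) (auto simp: less_imp_le)
qed (use assms in simp)

text \<open>These are the vertices between which a region determines all differences up to an open
  unit interval. Including $x_0$ makes bounds on single clocks a special case of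
  differences.\<close>

definition bounded_vertices :: "'x set \<Rightarrow> ('x \<Rightarrow> nat) \<Rightarrow> ('x \<Rightarrow> real) \<Rightarrow> 'x option set" where
  "bounded_vertices X \<alpha> v = insert None (Some ` {x \<in> X. v x \<le> \<alpha> x})"

text \<open>Within a region, a difference between bounded vertices is either constant or confined to
  an open interval between consecutive integers, so no weight can tell \<open>u\<close> from
  \<open>v\<close> there. On the remaining clocks only \<open>Above\<close> is known.\<close>

lemma ClosureD:
  assumes "v \<in> Closure X \<alpha> S"
  shows "\<exists>u\<in>S. (\<forall>x\<in>X. v x > \<alpha> x \<longrightarrow> u x > \<alpha> x) \<and>
    (\<forall>p\<in>bounded_vertices X \<alpha> v. \<forall>q\<in>bounded_vertices X \<alpha> v. \<forall>w.
      weight_sat (vertex_value u q - vertex_value u p) w \<longrightarrow>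
      weight_sat (vertex_value v q - vertex_value v p) w)"
proof -
  obtain R u where R: "region X \<alpha> R" "v \<in> R" "u \<in> R" "u \<in> S"
    using assms by (auto simp: Closure_def)
  then obtain I f where I: "\<And>x. x \<in> X \<Longrightarrow> clock_constr_valid (\<alpha> x) (I x)"
    and f: "\<And>x y. x \<in> X \<Longrightarrow> y \<in> X \<Longrightarrow> f x y \<in> {LT, EQ, GT}"
    and Req: "R = {v \<in> valuations X. (\<forall>x\<in>X. clock_constr_sat (\<alpha> x) (v x) (I x)) \<and>
       (\<forall>x\<in>X. \<forall>y\<in>X. is_Intv (I x) \<and> is_Intv (I y) \<longrightarrow>
          cmp_sat (f x y) (frac (v x)) (frac (v y)))}"
    unfolding region_def by blast
  have Iv: "clock_constr_sat (\<alpha> x) (v x) (I x)" and Iu: "clock_constr_sat (\<alpha> x) (u x) (I x)"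
    if "x \<in> X" for x using that R Req by auto
  have fv: "cmp_sat (f x y) (frac (v x)) (frac (v y))" and fu: "cmp_sat (f x y) (frac (u x)) (frac (u y))"
    if "x \<in> X" "y \<in> X" "is_Intv (I x)" "is_Intv (I y)" for x y
    using that R(2,3) unfolding Req by blast+
  \<comment> \<open>$x_0$ is treated as a clock with constraint \<open>Const 0\<close>, so that one
    case analysis covers all edges.\<close>
  define J where "J p = (case p of None \<Rightarrow> Const 0 | Some x \<Rightarrow> I x)" for p
  have J: "(\<exists>c. J p = Const c \<and> vertex_value v p = real c \<and> vertex_value u p = real c) \<or>
      (\<exists>c. J p = Intv c \<and> real c - 1 < vertex_value v p \<and> vertex_value v p < real c
        \<and> real c - 1 < vertex_value u p \<and> vertex_value u p < real c)"
    if "p \<in> bounded_vertices X \<alpha> v" for p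
  proof (cases p)
    case (Some x)
    then have "x \<in> X" "v x \<le> \<alpha> x" using that by (auto simp: bounded_vertices_def)
    then show ?thesis using Some Iv[of x] Iu[of x]
      by (cases "I x") (auto simp: J_def vertex_value_def)
  qed (simp add: J_def vertex_value_def)
  have frac: "frac r = r - (real c - 1)" if "real c - 1 < r" "r < real c" for r c
  proof -
    have "\<lfloor>r\<rfloor> = int c - 1" using that by (intro floor_unique) auto
    then show ?thesis by (simp add: frac_def)
  qed
  show ?thesis
  proof (intro bexI[of _ u] conjI ballI impI allI)
    show "u x > \<alpha> x" if "x \<in> X" "v x > \<alpha> x" for x
      using that I[of x] Iv[of x] Iu[of x] by (cases "I x") auto
    show "weight_sat (vertex_value v q - vertex_value v p) w"
      if p: "p \<in> bounded_vertices X \<alpha> v" and q: "q \<in> bounded_vertices X \<alpha> v"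
        and w: "weight_sat (vertex_value u q - vertex_value u p) w" for p q w
    proof (rule weight_sat_same_unit[OF _ w])
      let ?a = "vertex_value u q - vertex_value u p" and ?b = "vertex_value v q - vertex_value v p"
      consider (cc) c d where "J p = Const c" "J q = Const d" | (ci) c d where "J p = Const c" "J q = Intv d"
        | (ic) c d where "J p = Intv c" "J q = Const d" | (ii) c d where "J p = Intv c" "J q = Intv d"
        using J[OF p] J[OF q] by blast
      then show "?a = ?b \<or> (\<exists>k. of_int k < ?a \<and> ?a < of_int (k + 1) \<and> of_int k < ?b \<and> ?b < of_int (k + 1))"
      proof cases
        case cc
        then show ?thesis using J[OF p] J[OF q] by auto
      next
        case ci
        then show ?thesis using J[OF p] J[OF q] by (intro disjI2 exI[of _ "int d - 1 - int c"]) auto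
      next
        case ic
        then show ?thesis using J[OF p] J[OF q] by (intro disjI2 exI[of _ "int d - int c"]) auto
      next
        case ii
        then obtain x y where xy: "p = Some x" "q = Some y" "I x = Intv c" "I y = Intv d"
          by (auto simp: J_def split: option.splits)
        then have X: "x \<in> X" "y \<in> X" using p q by (auto simp: bounded_vertices_def)
        have b: "real c - 1 < v x" "v x < real c" "real c - 1 < u x" "u x < real c"
          "real d - 1 < v y" "v y < real d" "real d - 1 < u y" "u y < real d"
          using X xy Iv Iu by force+
        have *: "cmp_sat (f x y) (v x - (real c - 1)) (v y - (real d - 1))"
          "cmp_sat (f x y) (u x - (real c - 1)) (u y - (real d - 1))"
          using fv[OF X] fu[OF X] xy b by (simp_all add: frac)
        \<comment> \<open>The difference equals \<open>d - c\<close> plus the difference of the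
          fractional parts, whose sign is fixed by \<open>f x y\<close>; this determines the unit
          interval.\<close>
        consider "f x y = LT" | "f x y = EQ" | "f x y = GT" using f[OF X] by blast
        then show ?thesis
        proof cases
          case 1
          then show ?thesis using b * xy
            by (intro disjI2 exI[of _ "int d - int c"]) (auto simp: vertex_value_def)
        next
          case 2
          then show ?thesis using b * xy by (auto simp: vertex_value_def)
        next
          case 3
          then show ?thesis using b * xy
            by (intro disjI2 exI[of _ "int d - int c - 1"]) (auto simp: vertex_value_def)
        qed
      qed
    qed
  qed (use R in auto)
qed

text \<open>A clock above its bound contributes only \<open>Above\<close> to a region, so its value
  may change freely there. The fractional parts that are compared belong to clocks on which
  \<open>u\<close> and \<open>v\<close> agree.\<close>

lemma ClosureI:
  assumes "u \<in> S" "u \<in> valuations X" "v \<in> valuations X"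
    and uv: "\<And>x. x \<in> X \<Longrightarrow> u x = v x \<or> \<alpha> x < u x \<and> \<alpha> x < v x"
  shows "v \<in> Closure X \<alpha> S"
proof -
  \<comment> \<open>The region is read off \<open>v\<close>. The \<open>+ 1\<close> is due to
    \<open>Intv c\<close> being named after its upper end.\<close>
  define I where "I x = (if v x > \<alpha> x then Above else if v x = of_int \<lfloor>v x\<rfloor> then Const (nat \<lfloor>v x\<rfloor>)
    else Intv (nat \<lfloor>v x\<rfloor> + 1))" for x
  define f where "f x y = (if frac (v x) < frac (v y) then LT else if frac (v x) = frac (v y) then EQ else GT)"
    for x y
  define R where "R = {v \<in> valuations X. (\<forall>x\<in>X. clock_constr_sat (\<alpha> x) (v x) (I x)) \<and>
       (\<forall>x\<in>X. \<forall>y\<in>X. is_Intv (I x) \<and> is_Intv (I y) \<longrightarrow>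
          cmp_sat (f x y) (frac (v x)) (frac (v y)))}"
  have pos: "0 \<le> v x" if "x \<in> X" for x using that assms(3) by (auto simp: valuations_def)
  have valid: "clock_constr_valid (\<alpha> x) (I x)" if "x \<in> X" for x
    using pos[OF that] unfolding I_def by (auto; linarith)
  have sat: "clock_constr_sat (\<alpha> x) (v x) (I x)" if "x \<in> X" for x
    using pos[OF that] unfolding I_def by (auto; linarith)
  have cmp: "cmp_sat (f x y) (frac (v x)) (frac (v y))" for x y
    by (auto simp: f_def)
  have eq: "u x = v x" if "x \<in> X" "is_Intv (I x)" for x
    using uv[OF that(1)] that(2) by (auto simp: I_def split: if_splits)
  have usat: "clock_constr_sat (\<alpha> x) (u x) (I x)" if "x \<in> X" for x
    using uv[OF that] sat[OF that] by (auto simp: I_def)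
  have "v \<in> R" using assms(3) sat cmp by (auto simp: R_def)
  moreover have "u \<in> R" using assms(2) usat cmp eq by (auto simp: R_def)
  moreover have "region X \<alpha> R"
    unfolding region_def
  proof (intro conjI exI)
    show "\<forall>x\<in>X. clock_constr_valid (\<alpha> x) (I x)" using valid by blast
    show "\<forall>x\<in>X. \<forall>y\<in>X. f x y \<in> {LT, EQ, GT}" by (auto simp: f_def)
  qed (use \<open>v \<in> R\<close> R_def in auto)
  ultimately show ?thesis using assms(1) by (auto simp: Closure_def)
qed

section \<open>Tight solutions and integer bounds\<close>

lemma dg_solutions_tight:
  assumes X: "finite X" and G: "canonical_form X G" "v0 \<in> dg_solutions X G"
    and p: "p \<in> vertices X" and Q: "\<And>q. q \<in> Q \<Longrightarrow> q \<in> vertices X \<and> weight_sat (t q) (G p q)"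
  obtains v where "v \<in> dg_solutions X G" "\<And>q. q \<in> Q \<Longrightarrow> t q \<le> vertex_value v q - vertex_value v p"
proof -
  \<comment> \<open>The solution is extended from \<open>p\<close> alone. Each demand has to be
    compatible only with the edge from \<open>p\<close>, not with the other demands, which is why
    several edges leaving \<open>p\<close> can be tight at once.\<close>
  define A where "A q = (if q \<in> Q then {t q..} else UNIV)" for q
  have diag: "G p p = 0" using canonical_diag[OF G p] .
  have "\<exists>v\<in>dg_solutions X G. \<exists>c. (\<forall>q\<in>{p}. vertex_value v q = 0 - c) \<and>
    (\<forall>q\<in>vertices X - {p}. vertex_value v q + c \<in> A q)"
  proof (rule dg_solutions_extend[OF X G(1)])
    show "dg_solutions X G \<noteq> {}" "{p} \<subseteq> vertices X" "{p} \<noteq> {}" using G(2) p by auto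
    show "weight_sat (0 - 0) (G q q')" if "q \<in> {p}" "q' \<in> {p}" for q q'
      using that diag by (simp add: zero_weight_def zero_extended_def)
    show "\<exists>s\<in>A q. weight_sat (s - 0) (G p' q)" if "p' \<in> {p}" "q \<in> vertices X - {p}" for p' q
      using that Q weight_sat_ex[OF dg_solutions_bound[OF G(2) p, of q]] by (auto simp: A_def)
    show "s' \<in> A q" if "s \<in> A q" "s \<le> s'" for q s s'
      using that by (auto simp: A_def split: if_splits)
  qed
  then obtain v c where v: "v \<in> dg_solutions X G" "vertex_value v p = 0 - c"
    "\<And>q. q \<in> vertices X - {p} \<Longrightarrow> vertex_value v q + c \<in> A q"
    by blast
  show thesis
  proof
    show "t q \<le> vertex_value v q - vertex_value v p" if "q \<in> Q" for q
    proof (cases "q = p")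
      case True
      then show ?thesis using Q[OF that] diag by (simp add: zero_weight_def zero_extended_def)
    next
      case False
      then show ?thesis using v(2) v(3)[of q] Q[OF that] that by (auto simp: A_def)
    qed
  qed (rule v)
qed

text \<open>Since bounds are integers, the weight right above \<open>Le (Fin c)\<close> is
  \<open>Lt (Fin (c + 1))\<close>. This is how the failure of an upper bound on a weight of $Z'$
  leaves room beyond \<open>c\<close>.\<close>

lemma weight_sat_if_not_le:
  assumes "\<not> w \<le> Le (Fin c)" "r < of_int c + 1" shows "weight_sat r w"
proof (cases "bound w")
  case (Fin d)
  then have "(is_Lt w \<and> c + 1 \<le> d) \<or> (is_Le w \<and> c + 1 \<le> d)"
    using assms(1) by (cases w) (auto simp: weight_le_iff)
  then have "of_int (c + 1) \<le> (of_int d :: real)" by (auto simp only: of_int_le_iff)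
  then show ?thesis using Fin assms(2) by (cases w) auto
next
  case Pinf
  then show ?thesis by (cases w) auto
qed (use assms in \<open>auto simp: weight_le_iff\<close>)

lemma Le_le_iff_weight_sat: "Le (Fin c) \<le> w \<longleftrightarrow> weight_sat (of_int c) w"
  by (cases "(of_int c :: real, w)" rule: weight_sat.cases) (auto simp: weight_le_iff)

lemma weight_sat_le_Le:
  assumes "weight_sat r w" "w \<le> Le (Fin c)" shows "r \<le> of_int c"
  using weight_sat_mono[OF assms] by simp

text \<open>The floor of a finite weight names the largest integer \<open>e\<close> that satisfies
  it. Reals satisfying the weight may exceed \<open>e\<close>, but by less than 1.\<close>

lemma weight_floor_Fin:
  assumes "bound w \<noteq> Minf" "bound w \<noteq> Pinf"
  obtains e where "weight_floor w = Le (Fin e)" "weight_sat (of_int e) w"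
    "\<And>r. weight_sat r w \<Longrightarrow> r < of_int e + 1"
proof (cases "bound w")
  case (Fin d)
  show thesis
  proof (cases w)
    case (Le _)
    then show thesis using Fin by (intro that[of d]) auto
  next
    case (Lt _)
    then show thesis using Fin by (intro that[of "d - 1"]) (auto simp: one_extended_def)
  qed
qed (use assms in auto)

lemma dg_solutionsD:
  "v \<in> dg_solutions X G \<Longrightarrow> p \<in> vertices X \<Longrightarrow> q \<in> vertices X \<Longrightarrow>
    weight_sat (vertex_value v q - vertex_value v p) (G p q)"
  by (simp add: dg_solutions_def)

lemma vertex_value_simps [simp]: "vertex_value v None = 0" "vertex_value v (Some x) = v x"
  by (simp_all add: vertex_value_def)

lemma vertices_simps [simp]: "None \<in> vertices X" "Some x \<in> vertices X \<longleftrightarrow> x \<in> X"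
  by (auto simp: vertices_def)

text \<open>A weight above \<open>Le 0\<close> would admit 1/2, and tightness would give a solution
  with a negative clock. The lemma serves to exclude an infinite weight on this edge.\<close>

lemma lower_bound_nonpos:
  assumes "finite X" "canonical_form X G" "v0 \<in> dg_solutions X G" "dg_solutions X G \<subseteq> valuations X" "x \<in> X"
  shows "G (Some x) None \<le> Le 0"
proof (rule ccontr)
  assume "\<not> ?thesis"
  then have "weight_sat (1/2) (G (Some x) None)"
    by (intro weight_sat_if_not_le[of _ 0]) (auto simp: zero_extended_def)
  then obtain v where "v \<in> dg_solutions X G" "1/2 \<le> vertex_value v None - vertex_value v (Some x)"
    using dg_solutions_tight[OF assms(1-3), of "Some x" "{None}" "\<lambda>_. 1/2"] assms(5) by auto
  moreover from this have "v \<in> valuations X" using assms(4) by blast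
  then have "0 \<le> v x" using assms(5) by (auto simp: valuations_def)
  ultimately show False by simp
qed

section \<open>Inclusion when all three conditions fail\<close>

lemma subset_Closure:
  assumes X: "finite X"
    and G: "canonical_form X G" "dg_solutions X G \<subseteq> valuations X"
    and G': "canonical_form X G'" "dg_solutions X G' \<noteq> {}" "dg_solutions X G' \<subseteq> valuations X"
    and 1: "\<And>x. x \<in> X \<Longrightarrow> G' None (Some x) < G None (Some x) \<Longrightarrow> \<not> G' None (Some x) \<le> Le (Fin (int (\<alpha> x)))"
    and 2: "\<And>x. x \<in> X \<Longrightarrow> Le (Fin (- int (\<alpha> x))) \<le> G (Some x) None \<Longrightarrow> \<not> G' (Some x) None < G (Some x) None"
    and 3: "\<And>x y. x \<in> X \<Longrightarrow> y \<in> X \<Longrightarrow> Le (Fin (- int (\<alpha> x))) \<le> G (Some x) None \<Longrightarrow>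
      G' (Some x) (Some y) < G (Some x) (Some y) \<Longrightarrow>
      \<not> G' (Some x) (Some y) \<le> Le (Fin (int (\<alpha> y))) + weight_floor (G (Some x) None)"
  shows "dg_solutions X G \<subseteq> Closure X \<alpha> (dg_solutions X G')"
proof
  fix v assume v: "v \<in> dg_solutions X G"
  let ?B = "bounded_vertices X \<alpha> v"
  obtain v0' where v0': "v0' \<in> dg_solutions X G'" using G'(2) by blast
  \<comment> \<open>This is the premise on $Z_{x0}$ in conditions 2 and 3, which therefore can be
    used for every bounded clock.\<close>
  have low: "Le (Fin (- int (\<alpha> x))) \<le> G (Some x) None" if "x \<in> X" "v x \<le> \<alpha> x" for x
    unfolding Le_le_iff_weight_sat
    using dg_solutionsD[OF v, of "Some x" None] that by (auto intro: weight_sat_antimono)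
  \<comment> \<open>Either \<open>v x\<close> itself satisfies the edge of $Z'$, or the failure of
    condition 1 leaves room up to \<open>\<alpha> x + 1\<close>. That room lets an unbounded clock
    take a value just above \<open>\<alpha> x\<close>.\<close>
  have zx: "weight_sat r (G' None (Some x))"
    if "x \<in> X" "r < real (\<alpha> x) + 1" "r \<le> v x" for x r
  proof (cases "weight_sat (v x) (G' None (Some x))")
    case False
    then have "G' None (Some x) < G None (Some x)"
      using dg_solutionsD[OF v, of None "Some x"] that less_if_weight_sat by auto
    with 1 that show ?thesis by (intro weight_sat_if_not_le[of _ "int (\<alpha> x)"]) auto
  qed (use that weight_sat_antimono in blast)
  \<comment> \<open>The threshold \<open>r\<close> is such that \<open>v x + r\<close> exceeds
    \<open>\<alpha> y\<close>: if \<open>v y\<close> is above \<open>\<alpha> y\<close>, a value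
    between them is compatible with the edge. When $Z'$ is tighter than \<open>v\<close>, the
    failure of condition 3 allows \<open>r = \<alpha> y + e + 1\<close>, and
    \<open>- v x < e + 1\<close> by the choice of \<open>e\<close>.\<close>
  have xy: "\<exists>r>real (\<alpha> y) - v x. \<forall>s. s < r \<and> s \<le> v y - v x \<longrightarrow> weight_sat s (G' (Some x) (Some y))"
    if "x \<in> X" "y \<in> X" "v x \<le> \<alpha> x" for x y
  proof (cases "weight_sat (v y - v x) (G' (Some x) (Some y))")
    case True
    then show ?thesis using weight_sat_antimono gt_ex by blast
  next
    case False
    then have less: "G' (Some x) (Some y) < G (Some x) (Some y)"
      using dg_solutionsD[OF v, of "Some x" "Some y"] that less_if_weight_sat by auto
    have "bound (G (Some x) None) \<noteq> Pinf" "bound (G (Some x) None) \<noteq> Minf"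
      using lower_bound_nonpos[OF X G(1) v G(2) that(1)] dg_solutions_bound[OF v, of "Some x" None] that
      by (auto simp: weight_le_iff zero_extended_def)
    then obtain e where e: "weight_floor (G (Some x) None) = Le (Fin e)"
      "\<And>r. weight_sat r (G (Some x) None) \<Longrightarrow> r < of_int e + 1"
      using weight_floor_Fin by metis
    have "- v x < of_int e + 1"
      using e(2) dg_solutionsD[OF v, of "Some x" None] that by auto
    moreover have "\<not> G' (Some x) (Some y) \<le> Le (Fin (int (\<alpha> y) + e))"
      using 3[OF that(1,2) low[OF that(1,3)] less] e(1) by (simp add: plus_weight_def)
    then have "weight_sat s (G' (Some x) (Some y))" if "s < real (\<alpha> y) + of_int e + 1" for s
      using that by (intro weight_sat_if_not_le) auto
    ultimately show ?thesis by (intro exI[of _ "real (\<alpha> y) + of_int e + 1"]) auto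
  qed
  define A where "A p = (case p of None \<Rightarrow> UNIV | Some x \<Rightarrow> {real (\<alpha> x)<..})" for p :: "'a option"
  have sat: "weight_sat (vertex_value v q - vertex_value v p) (G' p q)" if "p \<in> ?B" "q \<in> ?B" for p q
  proof (cases p)
    case None
    show ?thesis
    proof (cases q)
      case None
      then show ?thesis using \<open>p = None\<close> canonical_diag[OF G'(1) v0', of None]
        by (simp add: zero_weight_def zero_extended_def)
    next
      case (Some x)
      then show ?thesis using that zx[of x "v x"] None by (auto simp: bounded_vertices_def)
    qed
  next
    case (Some x)
    then have x: "x \<in> X" "v x \<le> \<alpha> x" using that by (auto simp: bounded_vertices_def)
    show ?thesis
    proof (cases q)
      case None
      have "weight_sat (- v x) (G (Some x) None)" using dg_solutionsD[OF v, of "Some x" None] x by simp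
      moreover have "G (Some x) None \<le> G' (Some x) None" using 2[OF x(1) low[OF x]] by simp
      ultimately show ?thesis using Some None weight_sat_mono by auto
    next
      case q: (Some y)
      then have y: "y \<in> X" "v y \<le> \<alpha> y" using that by (auto simp: bounded_vertices_def)
      then show ?thesis using xy[OF x(1) y(1) x(2)] Some q by force
    qed
  qed
  have compat: "\<exists>t\<in>A q. weight_sat (t - vertex_value v p) (G' p q)" if p: "p \<in> ?B" and q: "q \<in> vertices X - ?B" for p q
  proof -
    obtain y where y: "q = Some y" "y \<in> X" "\<alpha> y < v y"
      using q by (fastforce simp: bounded_vertices_def vertices_def)
    show "\<exists>t\<in>A q. weight_sat (t - vertex_value v p) (G' p q)"
    proof (cases p)
      case None
      obtain t where "real (\<alpha> y) < t" "t < min (real (\<alpha> y) + 1) (v y)"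
        using y(3) dense[of "real (\<alpha> y)" "min (real (\<alpha> y) + 1) (v y)"] by auto
      then show ?thesis using zx[of y t] y None by (auto simp: A_def)
    next
      case (Some x)
      then have x: "x \<in> X" "v x \<le> \<alpha> x" using p by (auto simp: bounded_vertices_def)
      obtain r where r: "r > real (\<alpha> y) - v x" "\<And>s. s < r \<Longrightarrow> s \<le> v y - v x \<Longrightarrow> weight_sat s (G' (Some x) (Some y))"
        using xy[OF x(1) y(2) x(2)] by blast
      obtain t where "real (\<alpha> y) < t" "t < min (r + v x) (v y)"
        using y(3) r(1) dense[of "real (\<alpha> y)" "min (r + v x) (v y)"] by auto
      then show ?thesis using r(2)[of "t - v x"] y Some by (auto simp: A_def)
    qed
  qed
  have up: "t \<in> A p" if "s \<in> A p" "s \<le> t" for p s t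
    using that by (auto simp: A_def split: option.splits)
  have B: "?B \<subseteq> vertices X" "?B \<noteq> {}" by (auto simp: bounded_vertices_def)
  have "\<exists>u\<in>dg_solutions X G'. \<exists>c. (\<forall>p\<in>?B. vertex_value u p = vertex_value v p - c) \<and>
    (\<forall>q\<in>vertices X - ?B. vertex_value u q + c \<in> A q)"
    by (rule dg_solutions_extend[OF X G'(1,2) B]) (fact up sat compat)+
  then obtain u c where u: "u \<in> dg_solutions X G'" "\<And>p. p \<in> ?B \<Longrightarrow> vertex_value u p = vertex_value v p - c"
    "\<And>q. q \<in> vertices X - ?B \<Longrightarrow> vertex_value u q + c \<in> A q"
    by blast
  \<comment> \<open>$x_0$ is a bounded vertex with value 0 on both sides, so the shift vanishes and
    \<open>u\<close> agrees with \<open>v\<close> on all bounded clocks.\<close>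
  have "c = 0" using u(2)[of None] by (simp add: bounded_vertices_def)
  show "v \<in> Closure X \<alpha> (dg_solutions X G')"
  proof (rule ClosureI)
    show "u x = v x \<or> \<alpha> x < u x \<and> \<alpha> x < v x" if "x \<in> X" for x
    proof (cases "v x \<le> \<alpha> x")
      case True
      then show ?thesis using u(2)[of "Some x"] that \<open>c = 0\<close> by (auto simp: bounded_vertices_def)
    next
      case False
      then show ?thesis using u(3)[of "Some x"] that \<open>c = 0\<close> by (auto simp: bounded_vertices_def A_def)
    qed
  qed (use u v G G' in auto)
qed

section \<open>Each condition refutes the inclusion\<close>

lemma not_subset_Closure_upper:
  assumes X: "finite X" and G: "canonical_form X G" "v0 \<in> dg_solutions X G"
    and G': "v0' \<in> dg_solutions X G'" and x: "x \<in> X"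
    and less: "G' None (Some x) < G None (Some x)" and le: "G' None (Some x) \<le> Le (Fin (int (\<alpha> x)))"
  shows "\<not> dg_solutions X G \<subseteq> Closure X \<alpha> (dg_solutions X G')"
proof
  assume sub: "dg_solutions X G \<subseteq> Closure X \<alpha> (dg_solutions X G')"
  have "bound (G' None (Some x)) \<noteq> Minf" "bound (G' None (Some x)) \<noteq> Pinf"
    using dg_solutions_bound[OF G'] x le by (auto simp: weight_le_iff)
  then obtain r where r: "weight_sat r (G None (Some x))" "\<not> weight_sat r (G' None (Some x))"
    using less_weight_separate[OF less] by blast
  obtain v where v: "v \<in> dg_solutions X G" "r \<le> v x"
    using dg_solutions_tight[OF X G, of None "{Some x}" "\<lambda>_. r"] x r(1) by auto
  then have nsat: "\<not> weight_sat (v x) (G' None (Some x))" using r(2) weight_sat_antimono by blast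
  from v sub have "v \<in> Closure X \<alpha> (dg_solutions X G')" by blast
  then obtain u where u: "u \<in> dg_solutions X G'" "\<And>x. x \<in> X \<Longrightarrow> v x > \<alpha> x \<Longrightarrow> u x > \<alpha> x"
    "\<And>p q w. p \<in> bounded_vertices X \<alpha> v \<Longrightarrow> q \<in> bounded_vertices X \<alpha> v \<Longrightarrow>
      weight_sat (vertex_value u q - vertex_value u p) w \<Longrightarrow>
      weight_sat (vertex_value v q - vertex_value v p) w"
    by (blast dest: ClosureD)
  have usat: "weight_sat (u x) (G' None (Some x))" using dg_solutionsD[OF u(1), of None "Some x"] x by simp
  show False
  \<comment> \<open>If \<open>x\<close> is bounded, \<open>v\<close> inherits the constraint from
    \<open>u\<close>. Otherwise \<open>u x\<close> exceeds \<open>\<alpha> x\<close> as well, while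
    $Z'$ caps it at \<open>\<alpha> x\<close>.\<close>
  proof (cases "v x \<le> \<alpha> x")
    case True
    then show False using u(3)[of None "Some x"] usat nsat x by (auto simp: bounded_vertices_def)
  next
    case False
    then show False using u(2)[OF x] weight_sat_le_Le[OF usat le] by auto
  qed
qed

lemma not_subset_Closure_lower:
  assumes X: "finite X" and G: "canonical_form X G" "v0 \<in> dg_solutions X G" "dg_solutions X G \<subseteq> valuations X"
    and G': "v0' \<in> dg_solutions X G'" and x: "x \<in> X"
    and less: "G' (Some x) None < G (Some x) None" and le: "Le (Fin (- int (\<alpha> x))) \<le> G (Some x) None"
  shows "\<not> dg_solutions X G \<subseteq> Closure X \<alpha> (dg_solutions X G')"
proof
  assume sub: "dg_solutions X G \<subseteq> Closure X \<alpha> (dg_solutions X G')"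
  have "bound (G' (Some x) None) \<noteq> Minf" "bound (G' (Some x) None) \<noteq> Pinf"
    using dg_solutions_bound[OF G'] x less lower_bound_nonpos[OF X G x]
    by (auto simp: weight_le_iff less_weight_def zero_extended_def)
  then obtain r where r: "weight_sat r (G (Some x) None)" "\<not> weight_sat r (G' (Some x) None)"
    using less_weight_separate[OF less] by blast
  \<comment> \<open>Raising \<open>r\<close> to \<open>- \<alpha> x\<close> is permitted by the
    second half of condition 2 and forces \<open>v x \<le> \<alpha> x\<close>, so that the region of
    \<open>v\<close> respects the violated edge.\<close>
  have "weight_sat (max r (- real (\<alpha> x))) (G (Some x) None)"
    using r(1) le by (auto simp: max_def Le_le_iff_weight_sat)
  then obtain v where v: "v \<in> dg_solutions X G" "r \<le> - v x" "v x \<le> \<alpha> x"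
    using dg_solutions_tight[OF X G(1,2), of "Some x" "{None}" "\<lambda>_. max r (- real (\<alpha> x))"] x by auto
  then have nsat: "\<not> weight_sat (- v x) (G' (Some x) None)" using r(2) weight_sat_antimono by blast
  from v sub have "v \<in> Closure X \<alpha> (dg_solutions X G')" by blast
  then obtain u where u: "u \<in> dg_solutions X G'"
    "\<And>p q w. p \<in> bounded_vertices X \<alpha> v \<Longrightarrow> q \<in> bounded_vertices X \<alpha> v \<Longrightarrow>
      weight_sat (vertex_value u q - vertex_value u p) w \<Longrightarrow>
      weight_sat (vertex_value v q - vertex_value v p) w"
    by (blast dest: ClosureD)
  have "weight_sat (- u x) (G' (Some x) None)" using dg_solutionsD[OF u(1), of "Some x" None] x by simp
  then show False using u(2)[of "Some x" None] nsat x v(3) by (auto simp: bounded_vertices_def)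
qed

lemma not_subset_Closure_diff:
  assumes X: "finite X" and G: "canonical_form X G" "v0 \<in> dg_solutions X G" "dg_solutions X G \<subseteq> valuations X"
    and G': "v0' \<in> dg_solutions X G'" and x: "x \<in> X" and y: "y \<in> X"
    and low: "Le (Fin (- int (\<alpha> x))) \<le> G (Some x) None"
    and less: "G' (Some x) (Some y) < G (Some x) (Some y)"
    and le: "G' (Some x) (Some y) \<le> Le (Fin (int (\<alpha> y))) + weight_floor (G (Some x) None)"
  shows "\<not> dg_solutions X G \<subseteq> Closure X \<alpha> (dg_solutions X G')"
proof
  assume sub: "dg_solutions X G \<subseteq> Closure X \<alpha> (dg_solutions X G')"
  have "bound (G (Some x) None) \<noteq> Pinf" "bound (G (Some x) None) \<noteq> Minf"
    using lower_bound_nonpos[OF X G x] dg_solutions_bound[OF G(2), of "Some x" None] x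
    by (auto simp: weight_le_iff zero_extended_def)
  then obtain e where e: "weight_floor (G (Some x) None) = Le (Fin e)" "weight_sat (of_int e) (G (Some x) None)"
      "\<And>r. weight_sat r (G (Some x) None) \<Longrightarrow> r < of_int e + 1"
    using weight_floor_Fin by metis
  have le': "G' (Some x) (Some y) \<le> Le (Fin (int (\<alpha> y) + e))" using le e(1) by (simp add: plus_weight_def)
  have "of_int (- int (\<alpha> x)) < (of_int (e + 1) :: real)"
    using e(3) low by (simp add: Le_le_iff_weight_sat)
  then have e_ge: "- int (\<alpha> x) \<le> e" by (simp only: of_int_less_iff)
  have "bound (G' (Some x) (Some y)) \<noteq> Minf" "bound (G' (Some x) (Some y)) \<noteq> Pinf"
    using dg_solutions_bound[OF G'] x y le' by (auto simp: weight_le_iff)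
  then obtain r where r: "weight_sat r (G (Some x) (Some y))" "\<not> weight_sat r (G' (Some x) (Some y))"
    using less_weight_separate[OF less] by blast
  \<comment> \<open>Two edges leaving \<open>x\<close> are made tight together: the one to $x_0$
    gives \<open>v x \<le> - e\<close> and hence keeps \<open>x\<close> bounded, the one to
    \<open>y\<close> violates $Z'$.\<close>
  define t where "t p = (case p of None \<Rightarrow> of_int e | Some _ \<Rightarrow> r)" for p :: "'a option"
  have "q \<in> vertices X \<and> weight_sat (t q) (G (Some x) q)" if "q \<in> {None, Some y}" for q
    using that y r(1) e(2) by (auto simp: t_def)
  from dg_solutions_tight[OF X G(1,2) _ this] x obtain v where v: "v \<in> dg_solutions X G"
    "\<And>q. q \<in> {None, Some y} \<Longrightarrow> t q \<le> vertex_value v q - vertex_value v (Some x)"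
    by (metis vertices_simps(2))
  have v': "v x \<le> - of_int e" "r \<le> v y - v x"
    using v(2)[of None] v(2)[of "Some y"] by (auto simp: t_def)
  have vx: "v x \<le> \<alpha> x" using v'(1) e_ge by linarith
  have nsat: "\<not> weight_sat (v y - v x) (G' (Some x) (Some y))" using v'(2) r(2) weight_sat_antimono by blast
  from v sub have "v \<in> Closure X \<alpha> (dg_solutions X G')" by blast
  then obtain u where u: "u \<in> dg_solutions X G'" "\<And>x. x \<in> X \<Longrightarrow> v x > \<alpha> x \<Longrightarrow> u x > \<alpha> x"
    "\<And>p q w. p \<in> bounded_vertices X \<alpha> v \<Longrightarrow> q \<in> bounded_vertices X \<alpha> v \<Longrightarrow>
      weight_sat (vertex_value u q - vertex_value u p) w \<Longrightarrow>
      weight_sat (vertex_value v q - vertex_value v p) w"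
    by (blast dest: ClosureD)
  have usat: "weight_sat (u y - u x) (G' (Some x) (Some y))"
    using dg_solutionsD[OF u(1), of "Some x" "Some y"] x y by simp
  show False
  proof (cases "v y \<le> \<alpha> y")
    case True
    then show False using u(3)[of "Some x" "Some y"] usat nsat x y vx by (auto simp: bounded_vertices_def)
  next
    case False
    \<comment> \<open>The floor matters here: as \<open>e\<close> is an integer,
      \<open>v x \<le> - e\<close> is stable within the region. Then
      \<open>u y \<le> \<alpha> y + e + u x \<le> \<alpha> y\<close>, although \<open>y\<close> is
      above its bound in \<open>u\<close>.\<close>
    have "u x \<le> - of_int e"
    proof (rule ccontr)
      assume "\<not> ?thesis"
      then have "weight_sat (- u x) (Lt (Fin e))" by simp
      then show False
        using u(3)[of "Some x" None "Lt (Fin e)"] x vx v'(1) by (auto simp: bounded_vertices_def)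
    qed
    then show False using False u(2)[OF y] weight_sat_le_Le[OF usat le'] by auto
  qed
qed

section \<open>The equivalence, including empty zones\<close>

theorem theorem2:
  fixes X :: "'x set" and \<alpha> :: "'x \<Rightarrow> nat"
    and Z Z' :: "('x \<Rightarrow> real) set" and G G' :: "'x dgraph"
  assumes "finite X"
    and "zone X Z" and "zone X Z'"
    and "canonical_graph_of X Z G" and "canonical_graph_of X Z' G'"
  shows "\<not> Z \<subseteq> Closure X \<alpha> Z' \<longleftrightarrow>
    (\<exists>x\<in>X. \<exists>y\<in>X.
      (G' None (Some x) < G None (Some x) \<and> G' None (Some x) \<le> Le (Fin (int (\<alpha> x)))) \<or>
      (G' (Some x) None < G (Some x) None \<and> G (Some x) None \<ge> Le (Fin (- int (\<alpha> x)))) \<or>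
      (G (Some x) None \<ge> Le (Fin (- int (\<alpha> x))) \<and>
       G' (Some x) (Some y) < G (Some x) (Some y) \<and>
       G' (Some x) (Some y) \<le> Le (Fin (int (\<alpha> y))) + weight_floor (G (Some x) None)))"
    (is "_ \<longleftrightarrow> ?R")
proof -
  have Z: "canonical_form X G" "dg_solutions X G = Z" "Z \<subseteq> valuations X"
    and Z': "canonical_form X G'" "dg_solutions X G' = Z'" "Z' \<subseteq> valuations X"
    using assms by (auto simp: canonical_graph_of_def zone_def)
  have least: "Lt Minf \<le> w" for w by (cases "bound w") (auto simp: weight_le_iff)
  show ?thesis
  proof (cases "Z = {}")
    case True
    \<comment> \<open>No weight of $Z'$ lies strictly below the least weight, so all three
      conditions fail, in accordance with the trivial inclusion.\<close>
    then have "G p q = Lt Minf" if "p \<in> vertices X" "q \<in> vertices X" for p q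
      using that assms(4) by (auto simp: canonical_graph_of_def)
    then show ?thesis using True least by (auto simp: not_less[symmetric])
  next
    case False
    then obtain v0 where v0: "v0 \<in> dg_solutions X G" using Z by blast
    show ?thesis
    proof (cases "Z' = {}")
      case True
      \<comment> \<open>Every constraint mentions a clock. Over no clocks a zone is thus
        unconstrained and contains the only valuation, so it cannot be empty.\<close>
      have "X \<noteq> {}"
      proof
        assume "X = {}"
        obtain C where C: "\<forall>c\<in>C. set_constraint c \<subseteq> X"
          "Z' = {v \<in> valuations X. \<forall>c\<in>C. constraint_sat v c}"
          using assms(3) by (auto simp: zone_def)
        have "set_constraint c \<noteq> {}" for c :: "'x constraint" by (cases c) auto
        with C(1) \<open>X = {}\<close> have "C = {}" by auto
        with C(2) \<open>X = {}\<close> True show False by (auto simp: valuations_def)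
      qed
      then obtain x where x: "x \<in> X" by blast
      \<comment> \<open>Condition 1 holds at any clock: the convention for the empty zone puts the
        least weight on this edge, and a nonempty $Z$ has a larger one.\<close>
      have "G' None (Some x) = Lt Minf"
        using assms(5) True x by (auto simp: canonical_graph_of_def)
      moreover have "Lt Minf < G None (Some x)"
        using dg_solutions_bound[OF v0, of None "Some x"] x least[of "G None (Some x)"]
        by (cases "G None (Some x) = Lt Minf") (auto simp: order.order_iff_strict)
      ultimately have ?R using x least by (intro bexI[of _ x] disjI1) auto
      then show ?thesis using True False by (auto simp: Closure_def)
    next
      case False
      then obtain v0' where v0': "v0' \<in> dg_solutions X G'" using Z' by blast
      show ?thesis
      proof
        assume "\<not> Z \<subseteq> Closure X \<alpha> Z'"
        then show ?R
          using subset_Closure[of X G G' \<alpha>] assms(1) Z Z' False by blast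
      next
        assume ?R
        then show "\<not> Z \<subseteq> Closure X \<alpha> Z'"
          using not_subset_Closure_upper[OF assms(1) Z(1) v0 v0', of _ \<alpha>]
            not_subset_Closure_lower[OF assms(1) Z(1) v0 _ v0', of _ \<alpha>]
            not_subset_Closure_diff[OF assms(1) Z(1) v0 _ v0', of _ _ \<alpha>]
          unfolding Z(2) Z'(2) using Z(3) by blast
      qed
    qed
  qed
qed

end
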